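(* For any typing context $\Gamma$ (in which a variable may occur with several types), any $\lambda$-term $M$ and any type $A$, the following are equivalent: (1) $\Gamma_\cap\vdash_\omega M:A$ in $\Lambda_{\cap\omega}$; (2) $\Gamma\vdash_{s\omega} M:A$ in $\Lambda_{\cap\omega}^s$; (3) $\Gamma\vdash_{\ell\omega} M:A$ in $\Lambda_{\cap\omega}^\ell$.
   Context: $\lambda$-terms: $M::=x\mid MM\mid\lambda x.M$ modulo $\alpha$-conversion; $M[x:=N]$ capture-avoiding substitution. Types: $A::=\varphi\mid\omega\mid A\to A\mid A\cap A$. A typing context is a finite set of pairs $x:A$ ($\Gamma,x:A$ denotes $\Gamma\cup\{x:A\}$; $x\notin\Gamma$ means no $x:B$ lies in $\Gamma$); in $\Lambda_{\cap\omega}$ variables are pairwise distinct, in the other two systems a variable may occur with several types. $\Gamma_\cap$ assigns to each variable of $\Gamma$ the intersection of all types it has in $\Gamma$. $\Lambda_{\cap\omega}$: (Ax) $\Gamma,x:A\vdash x:A$; ($\to$I) from $\Gamma,x:A\vdash M:B$, $x\notin\Gamma$, infer $\Gamma\vdash\lambda x.M:A\to B$; ($\to$E) from $\Gamma\vdash M:A\to B$ and $\Gamma\vdash N:A$ infer $\Gamma\vdash MN:B$; ($\cap$I) from $\Gamma\vdash M:A$, $\Gamma\vdash M:B$ infer $\Gamma\vdash M:A\cap B$; ($\cap$E) from $\Gamma\vdash M:A\cap B$ infer $\Gamma\vdash M:A$ and $\Gamma\vdash M:B$; $(\omega)$ $\Gamma\vdash M:\omega$. $\Lambda_{\cap\omega}^s$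 ($n\ge0$): (Ax) $\Gamma,x:A\vdash x:A$; $(\mathsf{Beta})^s$ from $\Gamma\vdash M[x:=N]N_1\dots N_n:A$ and $\Gamma\vdash N:B$ infer $\Gamma\vdash(\lambda x.M)NN_1\dots N_n:A$; $(\mathsf{L}\to)$ from $\Gamma\vdash N:A_1$ and $\Gamma,y:A_2\vdash yN_1\dots N_n:B$, with $y\notin FV(N_1)\cup\dots\cup FV(N_n)$, $y\notin\Gamma$, infer $\Gamma,x:A_1\to A_2\vdash xNN_1\dots N_n:B$; $(\mathsf{R}\to)$ from $\Gamma,x:A\vdash M:B$, $x\notin\Gamma$, infer $\Gamma\vdash\lambda x.M:A\to B$; $(\mathsf{L}\cap)$ from $\Gamma,x:A_1,x:A_2\vdash xN_1\dots N_n:B$ infer $\Gamma,x:A_1\cap A_2\vdash xN_1\dots N_n:B$; $(\mathsf{R}\cap)$ from $\Gamma\vdash M:A$ and $\Gamma\vdash M:B$ infer $\Gamma\vdash M:A\cap B$; $(\omega)$ $\Gamma\vdash M:\omega$. $\Lambda_{\cap\omega}^\ell$: same as $\Lambda_{\cap\omega}^s$ but with $(\mathsf{Beta})^s$ replaced by $(\mathsf{Beta})^\ell$: from $\Gamma\vdash M[x:=N]N_1\dots N_n:A$ infer $\Gamma\vdash(\lambda x.M)NN_1\dots N_n:A$. *)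

theory Defs
  imports Main
begin

text \<open>
  Terms modulo \<open>\<alpha>\<close>-conversion are represented by de Bruijn indices; the indices that are not
  bound by any enclosing abstraction are the names of the free variables.
\<close>

datatype tm = Var nat | App tm tm (infixl \<open>\<degree>\<close> 200) | Lam tm

primrec lift :: "tm \<Rightarrow> nat \<Rightarrow> tm" where
  "lift (Var i) k = (if i < k then Var i else Var (Suc i))"
| "lift (M \<degree> N) k = lift M k \<degree> lift N k"
| "lift (Lam M) k = Lam (lift M (Suc k))"

text \<open>
  In \<open>M[k \<^bold>:= N]\<close> the binder of \<open>k\<close> disappears, so the indices above \<open>k\<close> are decremented: the
  \<open>\<beta>\<close>-contractum of \<open>Lam M \<degree> N\<close> is \<open>M[0 \<^bold>:= N]\<close>.
\<close>

primrec subst :: "tm \<Rightarrow> nat \<Rightarrow> tm \<Rightarrow> tm" (\<open>_[_ \<^bold>:= _]\<close> [300, 0, 0] 300) where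
  "(Var i)[k \<^bold>:= N] = (if k < i then Var (i - 1) else if i = k then N else Var i)"
| "(M \<degree> M')[k \<^bold>:= N] = M[k \<^bold>:= N] \<degree> M'[k \<^bold>:= N]"
| "(Lam M)[k \<^bold>:= N] = Lam (M[Suc k \<^bold>:= lift N 0])"

primrec FV :: "tm \<Rightarrow> nat set" where
  "FV (Var i) = {i}"
| "FV (M \<degree> N) = FV M \<union> FV N"
| "FV (Lam M) = {i. Suc i \<in> FV M}"

abbreviation apps :: "tm \<Rightarrow> tm list \<Rightarrow> tm" (infixl \<open>\<degree>\<degree>\<close> 150) where
  "M \<degree>\<degree> Ns \<equiv> foldl (\<degree>) M Ns"

text \<open>The type parameter is the set of type atoms.\<close>

datatype 'a ty =
    Atom 'a
  | Omega
  | Arrow "'a ty" "'a ty" (infixr \<open>\<^bold>\<rightarrow>\<close> 120)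
  | Inter "'a ty" "'a ty" (infixr \<open>\<^bold>\<inter>\<close> 130)

type_synonym 'a ctx = "(nat \<times> 'a ty) set"

abbreviation vars :: "'a ctx \<Rightarrow> nat set" where
  "vars \<Gamma> \<equiv> fst ` \<Gamma>"

text \<open>
  Below an abstraction the outer variables are renumbered by \<open>Suc\<close> and the bound one is \<open>0\<close>.
  Thus \<open>bind A \<Gamma>\<close> is the context \<open>\<Gamma>, x : A\<close> for the body of an abstraction; the condition
  \<open>x \<notin> \<Gamma>\<close> holds by construction.
\<close>

definition bind :: "'a ty \<Rightarrow> 'a ctx \<Rightarrow> 'a ctx" where
  "bind A \<Gamma> = insert (0, A) ((\<lambda>(i, B). (Suc i, B)) ` \<Gamma>)"

text \<open>
  The leaf rules of the three systems require the context to be finite (and, in the first system,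
  its variables to be pairwise distinct); all other rules propagate these conditions from
  the premises to the conclusion.
\<close>

inductive typ_omega :: "'a ctx \<Rightarrow> tm \<Rightarrow> 'a ty \<Rightarrow> bool"
  (\<open>_ \<turnstile>\<^sub>\<omega> _ : _\<close> [50, 50, 50] 50) where
  Ax: "\<lbrakk>finite \<Gamma>; single_valued (insert (x, A) \<Gamma>)\<rbrakk> \<Longrightarrow> insert (x, A) \<Gamma> \<turnstile>\<^sub>\<omega> Var x : A"
| ArrI: "bind A \<Gamma> \<turnstile>\<^sub>\<omega> M : B \<Longrightarrow> \<Gamma> \<turnstile>\<^sub>\<omega> Lam M : A \<^bold>\<rightarrow> B"
| ArrE: "\<lbrakk>\<Gamma> \<turnstile>\<^sub>\<omega> M : A \<^bold>\<rightarrow> B; \<Gamma> \<turnstile>\<^sub>\<omega> N : A\<rbrakk> \<Longrightarrow> \<Gamma> \<turnstile>\<^sub>\<omega> M \<degree> N : B"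
| IntI: "\<lbrakk>\<Gamma> \<turnstile>\<^sub>\<omega> M : A; \<Gamma> \<turnstile>\<^sub>\<omega> M : B\<rbrakk> \<Longrightarrow> \<Gamma> \<turnstile>\<^sub>\<omega> M : A \<^bold>\<inter> B"
| IntE1: "\<Gamma> \<turnstile>\<^sub>\<omega> M : A \<^bold>\<inter> B \<Longrightarrow> \<Gamma> \<turnstile>\<^sub>\<omega> M : A"
| IntE2: "\<Gamma> \<turnstile>\<^sub>\<omega> M : A \<^bold>\<inter> B \<Longrightarrow> \<Gamma> \<turnstile>\<^sub>\<omega> M : B"
| Om: "\<lbrakk>finite \<Gamma>; single_valued \<Gamma>\<rbrakk> \<Longrightarrow> \<Gamma> \<turnstile>\<^sub>\<omega> M : Omega"

inductive typ_s :: "'a ctx \<Rightarrow> tm \<Rightarrow> 'a ty \<Rightarrow> bool"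
  (\<open>_ \<turnstile>\<^sub>s _ : _\<close> [50, 50, 50] 50) where
  Ax: "finite \<Gamma> \<Longrightarrow> insert (x, A) \<Gamma> \<turnstile>\<^sub>s Var x : A"
| Beta: "\<lbrakk>\<Gamma> \<turnstile>\<^sub>s M[0 \<^bold>:= N] \<degree>\<degree> Ns : A; \<Gamma> \<turnstile>\<^sub>s N : B\<rbrakk> \<Longrightarrow> \<Gamma> \<turnstile>\<^sub>s Lam M \<degree> N \<degree>\<degree> Ns : A"
| LArr: "\<lbrakk>\<Gamma> \<turnstile>\<^sub>s N : A1; insert (y, A2) \<Gamma> \<turnstile>\<^sub>s Var y \<degree>\<degree> Ns : B;
    \<forall>P \<in> set Ns. y \<notin> FV P; y \<notin> vars \<Gamma>\<rbrakk>
    \<Longrightarrow> insert (x, A1 \<^bold>\<rightarrow> A2) \<Gamma> \<turnstile>\<^sub>s Var x \<degree> N \<degree>\<degree> Ns : B"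
| RArr: "bind A \<Gamma> \<turnstile>\<^sub>s M : B \<Longrightarrow> \<Gamma> \<turnstile>\<^sub>s Lam M : A \<^bold>\<rightarrow> B"
| LInt: "insert (x, A1) (insert (x, A2) \<Gamma>) \<turnstile>\<^sub>s Var x \<degree>\<degree> Ns : B
    \<Longrightarrow> insert (x, A1 \<^bold>\<inter> A2) \<Gamma> \<turnstile>\<^sub>s Var x \<degree>\<degree> Ns : B"
| RInt: "\<lbrakk>\<Gamma> \<turnstile>\<^sub>s M : A; \<Gamma> \<turnstile>\<^sub>s M : B\<rbrakk> \<Longrightarrow> \<Gamma> \<turnstile>\<^sub>s M : A \<^bold>\<inter> B"
| Om: "finite \<Gamma> \<Longrightarrow> \<Gamma> \<turnstile>\<^sub>s M : Omega"

inductive typ_l :: "'a ctx \<Rightarrow> tm \<Rightarrow> 'a ty \<Rightarrow> bool"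
  (\<open>_ \<turnstile>\<^sub>l _ : _\<close> [50, 50, 50] 50) where
  Ax: "finite \<Gamma> \<Longrightarrow> insert (x, A) \<Gamma> \<turnstile>\<^sub>l Var x : A"
| Beta: "\<Gamma> \<turnstile>\<^sub>l M[0 \<^bold>:= N] \<degree>\<degree> Ns : A \<Longrightarrow> \<Gamma> \<turnstile>\<^sub>l Lam M \<degree> N \<degree>\<degree> Ns : A"
| LArr: "\<lbrakk>\<Gamma> \<turnstile>\<^sub>l N : A1; insert (y, A2) \<Gamma> \<turnstile>\<^sub>l Var y \<degree>\<degree> Ns : B;
    \<forall>P \<in> set Ns. y \<notin> FV P; y \<notin> vars \<Gamma>\<rbrakk>
    \<Longrightarrow> insert (x, A1 \<^bold>\<rightarrow> A2) \<Gamma> \<turnstile>\<^sub>l Var x \<degree> N \<degree>\<degree> Ns : B"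
| RArr: "bind A \<Gamma> \<turnstile>\<^sub>l M : B \<Longrightarrow> \<Gamma> \<turnstile>\<^sub>l Lam M : A \<^bold>\<rightarrow> B"
| LInt: "insert (x, A1) (insert (x, A2) \<Gamma>) \<turnstile>\<^sub>l Var x \<degree>\<degree> Ns : B
    \<Longrightarrow> insert (x, A1 \<^bold>\<inter> A2) \<Gamma> \<turnstile>\<^sub>l Var x \<degree>\<degree> Ns : B"
| RInt: "\<lbrakk>\<Gamma> \<turnstile>\<^sub>l M : A; \<Gamma> \<turnstile>\<^sub>l M : B\<rbrakk> \<Longrightarrow> \<Gamma> \<turnstile>\<^sub>l M : A \<^bold>\<inter> B"
| Om: "finite \<Gamma> \<Longrightarrow> \<Gamma> \<turnstile>\<^sub>l M : Omega"

text \<open>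
  Types are syntactic, so the intersection of a finite nonempty set of types is determined only up
  to the order and the bracketing of its members. \<open>inter_of S A\<close> says that \<open>A\<close> is one of these
  intersections, each member of \<open>S\<close> being used exactly once; \<open>inter_ctx \<Gamma> \<Delta>\<close> says
  that \<open>\<Delta>\<close> is \<open>\<Gamma>\<^sub>\<inter>\<close> for some such choice at each variable.
\<close>

inductive inter_of :: "'a ty set \<Rightarrow> 'a ty \<Rightarrow> bool" where
  single: "inter_of {A} A"
| union: "\<lbrakk>inter_of S A; inter_of T B; S \<inter> T = {}\<rbrakk> \<Longrightarrow> inter_of (S \<union> T) (A \<^bold>\<inter> B)"

definition inter_ctx :: "'a ctx \<Rightarrow> 'a ctx \<Rightarrow> bool" where
  "inter_ctx \<Gamma> \<Delta> \<longleftrightarrow>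
     single_valued \<Delta> \<and> vars \<Delta> = vars \<Gamma> \<and> (\<forall>(x, A) \<in> \<Delta>. inter_of {B. (x, B) \<in> \<Gamma>} A)"

lemma inter_of_exists:
  assumes "finite S" "S \<noteq> {}"
  shows "\<exists>A. inter_of S A"
  using assms
proof (induction S rule: finite_ne_induct)
  case (singleton A)
  then show ?case using inter_of.single by blast
next
  case (insert B S)
  then obtain A where "inter_of S A" by blast
  then have "inter_of ({B} \<union> S) (B \<^bold>\<inter> A)"
    using insert.hyps by (intro inter_of.union inter_of.single) auto
  then show ?case by auto
qed

lemma inter_ctx_exists:
  assumes "finite \<Gamma>"
  shows "\<exists>\<Delta>. inter_ctx \<Gamma> \<Delta>"
proof -
  have "\<exists>A. inter_of {B. (x, B) \<in> \<Gamma>} A" if "x \<in> vars \<Gamma>" for x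
  proof (rule inter_of_exists)
    have "{B. (x, B) \<in> \<Gamma>} \<subseteq> snd ` \<Gamma>" by force
    then show "finite {B. (x, B) \<in> \<Gamma>}" using assms finite_surj by blast
    show "{B. (x, B) \<in> \<Gamma>} \<noteq> {}" using that by auto
  qed
  then obtain f where f: "inter_of {B. (x, B) \<in> \<Gamma>} (f x)" if "x \<in> vars \<Gamma>" for x
    by metis
  have "inter_ctx \<Gamma> ((\<lambda>x. (x, f x)) ` vars \<Gamma>)"
    using f unfolding inter_ctx_def by (auto simp: single_valued_def image_image)
  then show ?thesis by blast
qed

end

theory Submission
  imports Defs
begin

text \<open>
  Since \<open>\<omega>\<close> types every term, the extra premise of the rule Beta of the system \<open>s\<close> is harmless,
  so \<open>s\<close> and \<open>\<ell>\<close> coincide. In the passage from \<open>\<ell>\<close> to natural deduction, the left rules extend a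
  substitution and Beta is subject expansion: the argument receives the intersection of the types
  of its copies, or \<open>\<omega>\<close> if there are none. The converse is a cut elimination, obtained from a Kripke
  logical relation: a term realizes an arrow type in a context if it has that type in the system
  \<open>\<ell>\<close> and, after any renaming into another context, maps realizers to realizers. Derivable terms
  with a variable at the head are realizers, and the realizers of a type are closed under head
  expansion, so every term typable in natural deduction is a realizer of its type and hence
  derivable in \<open>\<ell>\<close>.
\<close>

section \<open>Renaming and parallel substitution\<close>

definition up_ren :: "(nat \<Rightarrow> nat) \<Rightarrow> nat \<Rightarrow> nat" where
  "up_ren r = case_nat 0 (Suc \<circ> r)"

primrec ren :: "(nat \<Rightarrow> nat) \<Rightarrow> tm \<Rightarrow> tm" where
  "ren r (Var i) = Var (r i)"
| "ren r (M \<degree> N) = ren r M \<degree> ren r N"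
| "ren r (Lam M) = Lam (ren (up_ren r) M)"

definition up :: "(nat \<Rightarrow> tm) \<Rightarrow> nat \<Rightarrow> tm" where
  "up \<sigma> = case_nat (Var 0) (ren Suc \<circ> \<sigma>)"

primrec psub :: "(nat \<Rightarrow> tm) \<Rightarrow> tm \<Rightarrow> tm" where
  "psub \<sigma> (Var i) = \<sigma> i"
| "psub \<sigma> (M \<degree> N) = psub \<sigma> M \<degree> psub \<sigma> N"
| "psub \<sigma> (Lam M) = Lam (psub (up \<sigma>) M)"

lemma up_ren_simps [simp]: "up_ren r 0 = 0" "up_ren r (Suc i) = Suc (r i)"
  by (simp_all add: up_ren_def)

lemma up_simps [simp]: "up \<sigma> 0 = Var 0" "up \<sigma> (Suc i) = ren Suc (\<sigma> i)"
  by (simp_all add: up_def)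

lemma case_nat_comp_Suc [simp]: "case_nat a g \<circ> Suc = g"
  by (simp add: fun_eq_iff)

lemma up_comp_Suc [simp]: "up \<sigma> \<circ> Suc = ren Suc \<circ> \<sigma>"
  by (simp add: up_def)

lemma lift_eq_ren: "lift M k = ren (\<lambda>i. if i < k then i else Suc i) M"
proof (induction M arbitrary: k)
  case (Lam M)
  have "up_ren (\<lambda>i. if i < k then i else Suc i) = (\<lambda>i. if i < Suc k then i else Suc i)"
    by (simp add: up_ren_def fun_eq_iff split: nat.split)
  then show ?case by (simp add: Lam)
qed auto

lemma lift_0_eq_ren: "lift M 0 = ren Suc M"
  by (simp add: lift_eq_ren)

lemma subst_eq_psub:
  "M[k \<^bold>:= N] = psub (\<lambda>i. if k < i then Var (i - 1) else if i = k then N else Var i) M"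
proof (induction M arbitrary: k N)
  case (Lam M)
  have "up (\<lambda>i. if k < i then Var (i - 1) else if i = k then N else Var i) =
    (\<lambda>i. if Suc k < i then Var (i - 1) else if i = Suc k then lift N 0 else Var i)"
    by (auto simp: up_def lift_0_eq_ren fun_eq_iff split: nat.split)
  then show ?case by (simp add: Lam)
qed auto

lemma subst_0_eq_psub: "M[0 \<^bold>:= N] = psub (case_nat N Var) M"
proof -
  have "(\<lambda>i. if 0 < i then Var (i - 1) else if i = 0 then N else Var i) = case_nat N Var"
    by (simp add: fun_eq_iff split: nat.split)
  then show ?thesis by (simp only: subst_eq_psub)
qed

lemma up_Var_comp: "up (Var \<circ> r) = Var \<circ> up_ren r"
  by (simp add: up_def up_ren_def fun_eq_iff split: nat.split)

lemma ren_eq_psub: "ren r M = psub (Var \<circ> r) M"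
  by (induction M arbitrary: r) (simp_all add: up_Var_comp)

lemma up_Var: "up Var = Var"
  by (simp add: up_def fun_eq_iff split: nat.split)

lemma psub_Var [simp]: "psub Var M = M"
  by (induction M) (simp_all add: up_Var)

lemma ren_id [simp]: "ren id M = M"
  by (simp add: ren_eq_psub)

lemma up_ren_comp: "up_ren r \<circ> up_ren s = up_ren (r \<circ> s)"
  by (simp add: up_ren_def fun_eq_iff split: nat.split)

lemma ren_ren: "ren r (ren s M) = ren (r \<circ> s) M"
  by (induction M arbitrary: r s) (simp_all add: up_ren_comp)

lemma up_comp_up_ren: "up \<sigma> \<circ> up_ren r = up (\<sigma> \<circ> r)"
  by (simp add: up_def up_ren_def fun_eq_iff split: nat.split)

lemma psub_ren: "psub \<sigma> (ren r M) = psub (\<sigma> \<circ> r) M"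
  by (induction M arbitrary: r \<sigma>) (simp_all add: up_comp_up_ren)

lemma ren_comp_up: "ren (up_ren r) \<circ> up \<sigma> = up (ren r \<circ> \<sigma>)"
proof -
  have "ren (up_ren r) (ren Suc N) = ren Suc (ren r N)" for N
    by (simp add: ren_ren comp_def)
  then show ?thesis by (simp add: up_def fun_eq_iff split: nat.split)
qed

lemma ren_psub: "ren r (psub \<sigma> M) = psub (ren r \<circ> \<sigma>) M"
  by (induction M arbitrary: r \<sigma>) (simp_all add: ren_comp_up)

lemma psub_comp_up: "psub (up \<sigma>) \<circ> up \<tau> = up (psub \<sigma> \<circ> \<tau>)"
proof -
  have "psub (up \<sigma>) (ren Suc N) = ren Suc (psub \<sigma> N)" for N
    by (simp add: psub_ren ren_psub)
  then show ?thesis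
    by (simp add: up_def[of \<tau>] up_def[of "psub \<sigma> \<circ> \<tau>"] fun_eq_iff split: nat.split)
qed

lemma psub_psub: "psub \<sigma> (psub \<tau> M) = psub (psub \<sigma> \<circ> \<tau>) M"
  by (induction M arbitrary: \<sigma> \<tau>) (simp_all add: psub_comp_up)

lemma psub_up_subst: "(psub (up \<sigma>) M)[0 \<^bold>:= N] = psub (case_nat N \<sigma>) M"
proof -
  have "psub (case_nat N Var) \<circ> up \<sigma> = case_nat N \<sigma>"
    by (simp add: up_def psub_ren fun_eq_iff split: nat.split)
  then show ?thesis by (simp add: subst_0_eq_psub psub_psub)
qed

lemma psub_subst: "psub \<sigma> (M[0 \<^bold>:= N]) = (psub (up \<sigma>) M)[0 \<^bold>:= psub \<sigma> N]"
proof -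
  have "psub \<sigma> \<circ> case_nat N Var = case_nat (psub \<sigma> N) \<sigma>"
    by (simp add: fun_eq_iff split: nat.split)
  then show ?thesis
    unfolding psub_up_subst by (simp add: subst_0_eq_psub psub_psub)
qed

lemma ren_subst: "ren r (M[0 \<^bold>:= N]) = (ren (up_ren r) M)[0 \<^bold>:= ren r N]"
  by (simp add: ren_eq_psub psub_subst up_Var_comp)

lemma ren_up_ren_Suc_subst_Var_0: "(ren (up_ren Suc) M)[0 \<^bold>:= Var 0] = M"
proof -
  have "case_nat (Var 0) Var \<circ> up_ren Suc = Var"
    by (simp add: up_ren_def fun_eq_iff split: nat.split)
  then show ?thesis by (simp add: subst_0_eq_psub psub_ren)
qed

lemma ren_apps [simp]: "ren r (M \<degree>\<degree> Ns) = ren r M \<degree>\<degree> map (ren r) Ns"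
  by (induction Ns arbitrary: M) auto

lemma psub_apps [simp]: "psub \<sigma> (M \<degree>\<degree> Ns) = psub \<sigma> M \<degree>\<degree> map (psub \<sigma>) Ns"
  by (induction Ns arbitrary: M) auto

lemma FV_Lam: "FV (Lam M) = Suc -` FV M"
  by auto

lemma finite_FV [simp]: "finite (FV M)"
  by (induction M) (simp_all add: FV_Lam finite_vimageI del: FV.simps(3))

lemma FV_ren: "FV (ren r M) = r ` FV M"
proof (induction M arbitrary: r)
  case (Lam M)
  have "Suc i = up_ren r j \<longleftrightarrow> (\<exists>k. j = Suc k \<and> i = r k)" for i j
    by (cases j) auto
  then show ?case by (auto simp: Lam image_iff)
qed auto

lemma psub_cong: "(\<And>i. i \<in> FV M \<Longrightarrow> \<sigma> i = \<tau> i) \<Longrightarrow> psub \<sigma> M = psub \<tau> M"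
proof (induction M arbitrary: \<sigma> \<tau>)
  case (App M N)
  have "psub \<sigma> M = psub \<tau> M" "psub \<sigma> N = psub \<tau> N"
    by (rule App.IH, simp add: App.prems)+
  then show ?case by simp
next
  case (Lam M)
  have "psub (up \<sigma>) M = psub (up \<tau>) M"
    using Lam.prems by (intro Lam.IH) (auto simp: up_def split: nat.split)
  then show ?case by simp
qed simp

lemma psub_fun_upd_apps_fresh:
  assumes "\<forall>P \<in> set Ns. y \<notin> FV P"
  shows "psub (\<sigma>(y := M)) (Var y \<degree>\<degree> Ns) = M \<degree>\<degree> map (psub \<sigma>) Ns"
proof -
  have "psub (\<sigma>(y := M)) P = psub \<sigma> P" if "P \<in> set Ns" for P
    using that assms by (intro psub_cong) auto
  then show ?thesis by (simp cong: map_cong)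
qed

lemma ren_fun_upd_apps_fresh:
  assumes "\<forall>P \<in> set Ns. y \<notin> FV P"
  shows "ren (r(y := z)) (Var y \<degree>\<degree> Ns) = Var z \<degree>\<degree> map (ren r) Ns"
  using psub_fun_upd_apps_fresh[OF assms, of "Var \<circ> r" "Var z"]
  by (simp add: ren_eq_psub fun_upd_comp cong: map_cong)

section \<open>Contexts\<close>

lemma mem_bind [simp]:
  "(0, B) \<in> bind A \<Gamma> \<longleftrightarrow> B = A" "(Suc i, B) \<in> bind A \<Gamma> \<longleftrightarrow> (i, B) \<in> \<Gamma>"
  by (auto simp: bind_def)

definition unbind :: "'a ctx \<Rightarrow> 'a ctx" where
  "unbind \<Gamma> = {(i, A). (Suc i, A) \<in> \<Gamma>}"

lemma mem_unbind [simp]: "(i, A) \<in> unbind \<Gamma> \<longleftrightarrow> (Suc i, A) \<in> \<Gamma>"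
  by (simp add: unbind_def)

lemma unbind_bind [simp]: "unbind (bind A \<Gamma>) = \<Gamma>"
  by auto

lemma finite_bind [simp]: "finite (bind A \<Gamma>) \<longleftrightarrow> finite \<Gamma>"
proof -
  have "inj_on (\<lambda>(i, B). (Suc i, B)) \<Gamma>" by (auto simp: inj_on_def)
  then show ?thesis by (simp add: bind_def finite_image_iff)
qed

definition wf_ctx :: "'a ctx \<Rightarrow> bool" where
  "wf_ctx \<Gamma> \<longleftrightarrow> finite \<Gamma> \<and> single_valued \<Gamma>"

lemma wf_ctx_unbind: "wf_ctx \<Gamma> \<Longrightarrow> wf_ctx (unbind \<Gamma>)"
proof -
  assume "wf_ctx \<Gamma>"
  moreover have "unbind \<Gamma> = map_prod Suc id -` \<Gamma>" by auto
  ultimately show ?thesis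
    by (auto simp: wf_ctx_def single_valued_def intro!: finite_vimageI prod.inj_map)
qed

lemma wf_ctx_bind [simp]: "wf_ctx (bind A \<Gamma>) \<longleftrightarrow> wf_ctx \<Gamma>"
proof
  show "wf_ctx \<Gamma>" if "wf_ctx (bind A \<Gamma>)"
    using wf_ctx_unbind[OF that] by simp
  show "wf_ctx (bind A \<Gamma>)" if "wf_ctx \<Gamma>"
    using that by (auto simp: wf_ctx_def single_valued_def bind_def)
qed

text \<open>
  The judgement \<open>J\<close> will be membership in another context, for which \<open>\<sigma>\<close> is a renaming, or, for a
  substitution \<open>\<sigma>\<close>, derivability in one of the systems or realizability.
\<close>

definition satisfies :: "('b \<Rightarrow> 'a ty \<Rightarrow> bool) \<Rightarrow> (nat \<Rightarrow> 'b) \<Rightarrow> 'a ctx \<Rightarrow> bool" where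
  "satisfies J \<sigma> \<Gamma> \<longleftrightarrow> (\<forall>x A. (x, A) \<in> \<Gamma> \<longrightarrow> J (\<sigma> x) A)"

abbreviation renames :: "(nat \<Rightarrow> nat) \<Rightarrow> 'a ctx \<Rightarrow> 'a ctx \<Rightarrow> bool" where
  "renames r \<Gamma> \<Gamma>' \<equiv> satisfies (\<lambda>x A. (x, A) \<in> \<Gamma>') r \<Gamma>"

lemma satisfiesD: "\<lbrakk>satisfies J \<sigma> \<Gamma>; (x, A) \<in> \<Gamma>\<rbrakk> \<Longrightarrow> J (\<sigma> x) A"
  by (simp add: satisfies_def)

lemma satisfies_mono:
  "\<lbrakk>satisfies J \<sigma> \<Gamma>; \<And>x A. \<lbrakk>(x, A) \<in> \<Gamma>; J (\<sigma> x) A\<rbrakk> \<Longrightarrow> J' (\<tau> x) A\<rbrakk> \<Longrightarrow> satisfies J' \<tau> \<Gamma>"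
  by (simp add: satisfies_def)

lemma satisfies_insert [simp]:
  "satisfies J \<sigma> (insert (x, A) \<Gamma>) \<longleftrightarrow> J (\<sigma> x) A \<and> satisfies J \<sigma> \<Gamma>"
  by (auto simp: satisfies_def)

lemma satisfies_Un: "satisfies J \<sigma> (\<Gamma> \<union> \<Delta>) \<longleftrightarrow> satisfies J \<sigma> \<Gamma> \<and> satisfies J \<sigma> \<Delta>"
  by (auto simp: satisfies_def)

lemma satisfies_fun_upd_fresh [simp]:
  "y \<notin> vars \<Gamma> \<Longrightarrow> satisfies J (\<sigma>(y := M)) \<Gamma> \<longleftrightarrow> satisfies J \<sigma> \<Gamma>"
  unfolding satisfies_def by (metis fst_conv fun_upd_other image_eqI)

lemma satisfies_iff_unbind:
  "satisfies J \<sigma> \<Gamma> \<longleftrightarrow> (\<forall>A. (0, A) \<in> \<Gamma> \<longrightarrow> J (\<sigma> 0) A) \<and> satisfies J (\<sigma> \<circ> Suc) (unbind \<Gamma>)"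
proof -
  have "P x" if "P 0" "\<forall>i. P (Suc i)" for P x
    using that by (cases x) simp_all
  then have "(\<forall>x. P x) \<longleftrightarrow> P 0 \<and> (\<forall>i. P (Suc i))" for P
    by blast
  then show ?thesis unfolding satisfies_def comp_def mem_unbind .
qed

lemma satisfies_bind:
  "satisfies J \<sigma> (bind A \<Gamma>) \<longleftrightarrow> J (\<sigma> 0) A \<and> satisfies J (\<sigma> \<circ> Suc) \<Gamma>"
  by (simp add: satisfies_iff_unbind[of _ _ "bind A \<Gamma>"])

lemma renames_bind: "renames r \<Gamma> \<Gamma>' \<Longrightarrow> renames (up_ren r) (bind A \<Gamma>) (bind A \<Gamma>')"
  by (simp add: satisfies_bind) (simp add: satisfies_def)

lemma renames_insert:
  "renames r \<Gamma> \<Gamma>' \<Longrightarrow> renames r (insert (x, A) \<Gamma>) (insert (r x, A) \<Gamma>')"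
  by (auto simp: satisfies_def)

lemma renames_insert_fresh:
  "\<lbrakk>renames r \<Gamma> \<Gamma>'; y \<notin> vars \<Gamma>\<rbrakk>
    \<Longrightarrow> renames (r(y := z)) (insert (y, A) \<Gamma>) (insert (z, A) \<Gamma>')"
  using renames_insert[of \<Gamma>' "r(y := z)" \<Gamma> y A] by simp

lemma renames_Suc_bind: "renames Suc \<Gamma> (bind A \<Gamma>)"
  by (simp add: satisfies_def)

lemma ex_fresh:
  fixes \<Gamma> :: "'a ctx"
  assumes "finite \<Gamma>"
  obtains y where "y \<notin> vars \<Gamma>" "\<forall>P \<in> set Ns. y \<notin> FV P"
proof -
  have "finite (vars \<Gamma> \<union> (\<Union>P \<in> set Ns. FV P))" using assms by simp
  from ex_new_if_finite[OF infinite_UNIV_nat this] that show thesis by auto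
qed

lemma inter_of_iff:
  assumes "inter_of S A" and "\<And>B C. P (B \<^bold>\<inter> C) \<longleftrightarrow> P B \<and> P C"
  shows "P A \<longleftrightarrow> (\<forall>B \<in> S. P B)"
  using assms(1) by (induction rule: inter_of.induct) (auto simp: assms(2))

lemma satisfies_inter_ctx_iff:
  assumes "inter_ctx \<Gamma> \<Delta>" and "\<And>M B C. J M (B \<^bold>\<inter> C) \<longleftrightarrow> J M B \<and> J M C"
  shows "satisfies J \<sigma> \<Delta> \<longleftrightarrow> satisfies J \<sigma> \<Gamma>"
proof -
  have J_iff: "J (\<sigma> x) A \<longleftrightarrow> (\<forall>B. (x, B) \<in> \<Gamma> \<longrightarrow> J (\<sigma> x) B)" if "(x, A) \<in> \<Delta>" for x A
    using inter_of_iff[of "{B. (x, B) \<in> \<Gamma>}" A "J (\<sigma> x)"] assms that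
    by (auto simp: inter_ctx_def)
  have "\<exists>A. (x, A) \<in> \<Delta>" if "(x, B) \<in> \<Gamma>" for x B
  proof -
    have "x \<in> vars \<Delta>" using assms(1) that by (force simp: inter_ctx_def)
    then show ?thesis by auto
  qed
  with J_iff show ?thesis unfolding satisfies_def by blast
qed

lemma wf_ctx_inter_ctx:
  assumes "finite \<Gamma>" "inter_ctx \<Gamma> \<Delta>"
  shows "wf_ctx \<Delta>"
proof -
  have "single_valued \<Delta>" "vars \<Delta> = vars \<Gamma>"
    using assms(2) by (simp_all add: inter_ctx_def)
  moreover from this have "inj_on fst \<Delta>" "finite (vars \<Delta>)"
    using assms(1) by (auto simp: inj_on_def single_valued_def)
  ultimately show ?thesis unfolding wf_ctx_def by (blast intro: finite_imageD)
qed

section \<open>Natural deduction\<close>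

lemma typ_omega_wf_ctx: "\<Gamma> \<turnstile>\<^sub>\<omega> M : A \<Longrightarrow> wf_ctx \<Gamma>"
proof (induction rule: typ_omega.induct)
  case (Ax \<Gamma> x A)
  then show ?case by (simp add: wf_ctx_def)
next
  case (Om \<Gamma> M)
  then show ?case by (simp add: wf_ctx_def)
qed simp_all

lemma typ_omega_Var: "\<lbrakk>(x, A) \<in> \<Gamma>; wf_ctx \<Gamma>\<rbrakk> \<Longrightarrow> \<Gamma> \<turnstile>\<^sub>\<omega> Var x : A"
  using typ_omega.Ax[of \<Gamma> x A] by (simp add: insert_absorb wf_ctx_def)

lemma typ_omega_Omega: "wf_ctx \<Gamma> \<Longrightarrow> \<Gamma> \<turnstile>\<^sub>\<omega> M : Omega"
  by (simp add: wf_ctx_def typ_omega.Om)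

lemma typ_omega_Inter_iff: "\<Gamma> \<turnstile>\<^sub>\<omega> M : A \<^bold>\<inter> B \<longleftrightarrow> \<Gamma> \<turnstile>\<^sub>\<omega> M : A \<and> \<Gamma> \<turnstile>\<^sub>\<omega> M : B"
  by (blast intro: typ_omega.IntI typ_omega.IntE1 typ_omega.IntE2)

lemma satisfies_typ_omega_inter_ctx_iff:
  "inter_ctx \<Gamma> \<Delta> \<Longrightarrow> satisfies (typ_omega \<Theta>) \<sigma> \<Delta> \<longleftrightarrow> satisfies (typ_omega \<Theta>) \<sigma> \<Gamma>"
  by (simp add: satisfies_inter_ctx_iff typ_omega_Inter_iff)

lemma satisfies_typ_omega_Var: "wf_ctx \<Gamma> \<Longrightarrow> satisfies (typ_omega \<Gamma>) Var \<Gamma>"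
  by (simp add: satisfies_def typ_omega_Var)

lemma typ_omega_ren:
  assumes "\<Gamma> \<turnstile>\<^sub>\<omega> M : A" "wf_ctx \<Gamma>'" "renames r (\<Gamma> \<inter> FV M \<times> UNIV) \<Gamma>'"
  shows "\<Gamma>' \<turnstile>\<^sub>\<omega> ren r M : A"
  using assms
proof (induction arbitrary: \<Gamma>' r rule: typ_omega.induct)
  case (Ax \<Gamma> x A)
  then show ?case by (simp add: typ_omega_Var satisfies_def)
next
  case (ArrI A \<Gamma> M B)
  have "(up_ren r x, C) \<in> bind A \<Gamma>'" if "x \<in> FV M" "(x, C) \<in> bind A \<Gamma>" for x C
    using that ArrI.prems(2) by (cases x) (auto simp: satisfies_def)
  then have "bind A \<Gamma>' \<turnstile>\<^sub>\<omega> ren (up_ren r) M : B"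
    using ArrI.prems(1) by (intro ArrI.IH) (simp_all add: satisfies_def)
  then show ?case by (simp add: typ_omega.ArrI)
next
  case (ArrE \<Gamma> M A B N)
  have "\<Gamma>' \<turnstile>\<^sub>\<omega> ren r M : A \<^bold>\<rightarrow> B" "\<Gamma>' \<turnstile>\<^sub>\<omega> ren r N : A"
    using ArrE.prems by (auto intro!: ArrE.IH simp: satisfies_def)
  then show ?case by (simp add: typ_omega.ArrE)
qed (blast intro: typ_omega_Omega typ_omega.IntI typ_omega.IntE1 typ_omega.IntE2)+

lemma typ_omega_strengthen:
  assumes "\<Gamma> \<turnstile>\<^sub>\<omega> M : A" "wf_ctx \<Gamma>'" "\<Gamma> \<inter> FV M \<times> UNIV \<subseteq> \<Gamma>'"
  shows "\<Gamma>' \<turnstile>\<^sub>\<omega> M : A"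
  using typ_omega_ren[of \<Gamma> M A \<Gamma>' id] assms by (auto simp: satisfies_def)

lemma typ_omega_ren_Suc_iff: "bind A \<Gamma> \<turnstile>\<^sub>\<omega> ren Suc M : B \<longleftrightarrow> \<Gamma> \<turnstile>\<^sub>\<omega> M : B"
proof
  assume lifted: "bind A \<Gamma> \<turnstile>\<^sub>\<omega> ren Suc M : B"
  have "wf_ctx \<Gamma>" using typ_omega_wf_ctx[OF lifted] by simp
  with lifted have "\<Gamma> \<turnstile>\<^sub>\<omega> ren (\<lambda>i. i - 1) (ren Suc M) : B"
    by (rule typ_omega_ren) (auto simp: FV_ren satisfies_def)
  then show "\<Gamma> \<turnstile>\<^sub>\<omega> M : B" by (simp add: ren_ren comp_def flip: id_def)
next
  assume "\<Gamma> \<turnstile>\<^sub>\<omega> M : B"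
  then show "bind A \<Gamma> \<turnstile>\<^sub>\<omega> ren Suc M : B"
    using typ_omega_wf_ctx by (intro typ_omega_ren) (auto simp: satisfies_def)
qed

lemma satisfies_typ_omega_up:
  assumes "satisfies (typ_omega \<Delta>) \<sigma> \<Gamma>" "wf_ctx \<Delta>"
  shows "satisfies (typ_omega (bind A \<Delta>)) (up \<sigma>) (bind A \<Gamma>)"
  using assms
  by (simp add: satisfies_bind typ_omega_Var) (simp add: satisfies_def typ_omega_ren_Suc_iff)

lemma typ_omega_psub:
  assumes "\<Gamma> \<turnstile>\<^sub>\<omega> M : A" "wf_ctx \<Delta>" "satisfies (typ_omega \<Delta>) \<sigma> \<Gamma>"
  shows "\<Delta> \<turnstile>\<^sub>\<omega> psub \<sigma> M : A"
  using assms
proof (induction arbitrary: \<Delta> \<sigma> rule: typ_omega.induct)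
  case (Ax \<Gamma> x A)
  then show ?case by simp
next
  case (ArrI A \<Gamma> M B)
  then have "bind A \<Delta> \<turnstile>\<^sub>\<omega> psub (up \<sigma>) M : B"
    by (intro ArrI.IH satisfies_typ_omega_up) simp_all
  then show ?case by (simp add: typ_omega.ArrI)
next
  case (ArrE \<Gamma> M A B N)
  then have "\<Delta> \<turnstile>\<^sub>\<omega> psub \<sigma> M : A \<^bold>\<rightarrow> B" "\<Delta> \<turnstile>\<^sub>\<omega> psub \<sigma> N : A" by blast+
  then show ?case by (simp add: typ_omega.ArrE)
qed (blast intro: typ_omega_Omega typ_omega.IntI typ_omega.IntE1 typ_omega.IntE2)+

lemma typ_omega_ctx_mono:
  assumes "\<Gamma> \<turnstile>\<^sub>\<omega> M : A" "wf_ctx \<Delta>" "satisfies (typ_omega \<Delta>) Var \<Gamma>"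
  shows "\<Delta> \<turnstile>\<^sub>\<omega> M : A"
  using typ_omega_psub[OF assms] by simp

section \<open>Subject expansion\<close>

definition typ_omega_via :: "'a ctx \<Rightarrow> (nat \<Rightarrow> tm) \<Rightarrow> tm \<Rightarrow> 'a ty \<Rightarrow> bool" where
  "typ_omega_via \<Gamma> \<sigma> M A \<longleftrightarrow> (\<exists>\<Theta>. satisfies (typ_omega \<Gamma>) \<sigma> \<Theta> \<and> \<Theta> \<turnstile>\<^sub>\<omega> M : A)"

lemma typ_omega_via_common_ctx:
  assumes "typ_omega_via \<Gamma> \<sigma> M A" "typ_omega_via \<Gamma> \<sigma> N B"
  obtains \<Theta> where "satisfies (typ_omega \<Gamma>) \<sigma> \<Theta>" "\<Theta> \<turnstile>\<^sub>\<omega> M : A" "\<Theta> \<turnstile>\<^sub>\<omega> N : B"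
proof -
  obtain \<Theta>\<^sub>1 \<Theta>\<^sub>2 where sat: "satisfies (typ_omega \<Gamma>) \<sigma> (\<Theta>\<^sub>1 \<union> \<Theta>\<^sub>2)"
    and typ_M: "\<Theta>\<^sub>1 \<turnstile>\<^sub>\<omega> M : A" and typ_N: "\<Theta>\<^sub>2 \<turnstile>\<^sub>\<omega> N : B"
    using assms by (auto simp: typ_omega_via_def satisfies_Un)
  have fin: "finite (\<Theta>\<^sub>1 \<union> \<Theta>\<^sub>2)"
    using typ_M typ_N by (auto dest!: typ_omega_wf_ctx simp: wf_ctx_def)
  then obtain \<Theta> where inter: "inter_ctx (\<Theta>\<^sub>1 \<union> \<Theta>\<^sub>2) \<Theta>" using inter_ctx_exists by blast
  then have wf: "wf_ctx \<Theta>" by (rule wf_ctx_inter_ctx[OF fin])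
  have "satisfies (typ_omega \<Theta>) Var (\<Theta>\<^sub>1 \<union> \<Theta>\<^sub>2)"
    using satisfies_typ_omega_Var[OF wf] by (simp flip: satisfies_typ_omega_inter_ctx_iff[OF inter])
  then have "\<Theta> \<turnstile>\<^sub>\<omega> M : A" "\<Theta> \<turnstile>\<^sub>\<omega> N : B"
    using typ_M typ_N wf by (auto simp: satisfies_Un intro: typ_omega_ctx_mono)
  moreover have "satisfies (typ_omega \<Gamma>) \<sigma> \<Theta>"
    using sat by (simp add: satisfies_typ_omega_inter_ctx_iff[OF inter])
  ultimately show thesis using that by blast
qed

lemma typ_omega_via_Var: "\<Gamma> \<turnstile>\<^sub>\<omega> \<sigma> x : A \<Longrightarrow> typ_omega_via \<Gamma> \<sigma> (Var x) A"
  unfolding typ_omega_via_def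
  by (rule exI[of _ "{(x, A)}"])
    (auto simp: satisfies_def wf_ctx_def single_valued_def intro!: typ_omega_Var)

lemma typ_omega_via_Omega: "typ_omega_via \<Gamma> \<sigma> M Omega"
  unfolding typ_omega_via_def
  by (rule exI[of _ "{}"]) (simp add: satisfies_def wf_ctx_def typ_omega_Omega)

lemma typ_omega_via_App:
  assumes "typ_omega_via \<Gamma> \<sigma> M (A \<^bold>\<rightarrow> B)" "typ_omega_via \<Gamma> \<sigma> N A"
  shows "typ_omega_via \<Gamma> \<sigma> (M \<degree> N) B"
  using assms
  by (rule typ_omega_via_common_ctx) (auto simp: typ_omega_via_def intro: typ_omega.ArrE)

lemma typ_omega_via_Inter_iff:
  "typ_omega_via \<Gamma> \<sigma> M (A \<^bold>\<inter> B) \<longleftrightarrow> typ_omega_via \<Gamma> \<sigma> M A \<and> typ_omega_via \<Gamma> \<sigma> M B"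
proof
  show "typ_omega_via \<Gamma> \<sigma> M A \<and> typ_omega_via \<Gamma> \<sigma> M B" if "typ_omega_via \<Gamma> \<sigma> M (A \<^bold>\<inter> B)"
    using that unfolding typ_omega_via_def typ_omega_Inter_iff by blast
  assume "typ_omega_via \<Gamma> \<sigma> M A \<and> typ_omega_via \<Gamma> \<sigma> M B"
  then obtain \<Theta> where "satisfies (typ_omega \<Gamma>) \<sigma> \<Theta>" "\<Theta> \<turnstile>\<^sub>\<omega> M : A" "\<Theta> \<turnstile>\<^sub>\<omega> M : B"
    using typ_omega_via_common_ctx by blast
  then show "typ_omega_via \<Gamma> \<sigma> M (A \<^bold>\<inter> B)"
    unfolding typ_omega_via_def typ_omega_Inter_iff by blast
qed

lemma typ_omega_via_Lam:
  assumes "typ_omega_via (bind A \<Gamma>) (up \<sigma>) M B"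
  shows "typ_omega_via \<Gamma> \<sigma> (Lam M) (A \<^bold>\<rightarrow> B)"
proof -
  obtain \<Theta> where sat: "satisfies (typ_omega (bind A \<Gamma>)) (up \<sigma>) \<Theta>" and typ_M: "\<Theta> \<turnstile>\<^sub>\<omega> M : B"
    using assms by (auto simp: typ_omega_via_def)
  let ?\<Theta> = "unbind \<Theta>"
  have wf: "wf_ctx ?\<Theta>" using typ_omega_wf_ctx[OF typ_M] by (rule wf_ctx_unbind)
  have "satisfies (typ_omega (bind A \<Gamma>)) (ren Suc \<circ> \<sigma>) ?\<Theta>"
    using sat satisfies_iff_unbind[of "typ_omega (bind A \<Gamma>)" "up \<sigma>" \<Theta>] by simp
  then have "satisfies (typ_omega \<Gamma>) \<sigma> ?\<Theta>"
    by (rule satisfies_mono) (simp add: typ_omega_ren_Suc_iff)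
  moreover have "bind A ?\<Theta> \<turnstile>\<^sub>\<omega> M : B"
    using typ_M
  proof (rule typ_omega_ctx_mono)
    have "bind A ?\<Theta> \<turnstile>\<^sub>\<omega> Var 0 : C" if "(0, C) \<in> \<Theta>" for C
    proof (rule typ_omega_strengthen)
      show "bind A \<Gamma> \<turnstile>\<^sub>\<omega> Var 0 : C" using satisfiesD[OF sat that] by simp
    qed (use wf in auto)
    then show "satisfies (typ_omega (bind A ?\<Theta>)) Var \<Theta>"
      using wf by (simp add: satisfies_iff_unbind[of _ _ \<Theta>]) (simp add: satisfies_def typ_omega_Var)
  qed (simp add: wf)
  ultimately show ?thesis unfolding typ_omega_via_def by (blast intro: typ_omega.ArrI)
qed

lemma typ_omega_psub_inv:
  assumes "\<Gamma> \<turnstile>\<^sub>\<omega> psub \<sigma> M : A"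
  shows "typ_omega_via \<Gamma> \<sigma> M A"
  using assms
proof (induction \<Gamma> "psub \<sigma> M" A arbitrary: \<sigma> M rule: typ_omega.induct)
  case (Ax \<Gamma> x A)
  then obtain z where "M = Var z" by (cases M) auto
  then show ?case using typ_omega.Ax[OF Ax.hyps(1,2)] Ax.hyps(3) by (simp add: typ_omega_via_Var)
next
  case (ArrI A \<Gamma> P B)
  show ?case
  proof (cases M)
    case (Var z)
    then show ?thesis
      using typ_omega.ArrI[OF ArrI.hyps(1)] ArrI.hyps(3) by (simp add: typ_omega_via_Var)
  next
    case (Lam Q)
    then show ?thesis using ArrI.hyps by (simp add: typ_omega_via_Lam)
  qed (use ArrI.hyps in simp)
next
  case (ArrE \<Gamma> P A B Q)
  show ?case
  proof (cases M)
    case (Var z)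
    then show ?thesis
      using typ_omega.ArrE[OF ArrE.hyps(1,3)] ArrE.hyps(5) by (simp add: typ_omega_via_Var)
  next
    case (App M\<^sub>1 M\<^sub>2)
    then have "typ_omega_via \<Gamma> \<sigma> M\<^sub>1 (A \<^bold>\<rightarrow> B)" "typ_omega_via \<Gamma> \<sigma> M\<^sub>2 A"
      using ArrE.hyps by simp_all
    then show ?thesis unfolding App by (rule typ_omega_via_App)
  qed (use ArrE.hyps in simp)
qed (simp_all add: typ_omega_via_Inter_iff typ_omega_via_Omega)

lemma typ_omega_beta_expand:
  assumes "\<Gamma> \<turnstile>\<^sub>\<omega> M[0 \<^bold>:= N] : A"
  shows "\<Gamma> \<turnstile>\<^sub>\<omega> Lam M \<degree> N : A"
proof -
  have wf: "wf_ctx \<Gamma>" using assms by (rule typ_omega_wf_ctx)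
  obtain \<Theta> where sat: "satisfies (typ_omega \<Gamma>) (case_nat N Var) \<Theta>" and typ_M: "\<Theta> \<turnstile>\<^sub>\<omega> M : A"
    using assms typ_omega_psub_inv unfolding subst_0_eq_psub typ_omega_via_def by blast
  obtain B where typ_N: "\<Gamma> \<turnstile>\<^sub>\<omega> N : B" and B_unique: "\<And>C. (0, C) \<in> \<Theta> \<Longrightarrow> C = B"
  proof (cases "\<exists>B. (0, B) \<in> \<Theta>")
    case True
    then obtain B where "(0, B) \<in> \<Theta>" by blast
    then show thesis
      using that satisfiesD[OF sat] typ_omega_wf_ctx[OF typ_M]
      by (force simp: wf_ctx_def dest: single_valuedD)
  next
    case False
    then show thesis using that typ_omega_Omega[OF wf] by blast
  qed
  have "satisfies (typ_omega (bind B \<Gamma>)) (Var \<circ> Suc) (unbind \<Theta>)"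
    using sat typ_omega_ren_Suc_iff[of B \<Gamma> "Var _"]
    by (simp add: satisfies_iff_unbind[of _ _ \<Theta>]) (simp add: satisfies_def)
  then have "satisfies (typ_omega (bind B \<Gamma>)) Var \<Theta>"
    using B_unique wf by (auto simp: satisfies_iff_unbind[of _ _ \<Theta>] intro: typ_omega_Var)
  then have "bind B \<Gamma> \<turnstile>\<^sub>\<omega> M : A"
    using typ_M wf by (simp add: typ_omega_ctx_mono)
  with typ_N show ?thesis by (blast intro: typ_omega.ArrI typ_omega.ArrE)
qed

lemma typ_omega_App_mono:
  assumes "\<Gamma> \<turnstile>\<^sub>\<omega> M \<degree> N : A" "\<And>B. \<Gamma> \<turnstile>\<^sub>\<omega> M : B \<Longrightarrow> \<Gamma> \<turnstile>\<^sub>\<omega> M' : B"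
  shows "\<Gamma> \<turnstile>\<^sub>\<omega> M' \<degree> N : A"
  using assms
  by (induction \<Gamma> "M \<degree> N" A rule: typ_omega.induct) (blast intro: typ_omega.intros)+

lemma typ_omega_apps_mono:
  assumes "\<Gamma> \<turnstile>\<^sub>\<omega> M \<degree>\<degree> Ns : A" "\<And>B. \<Gamma> \<turnstile>\<^sub>\<omega> M : B \<Longrightarrow> \<Gamma> \<turnstile>\<^sub>\<omega> M' : B"
  shows "\<Gamma> \<turnstile>\<^sub>\<omega> M' \<degree>\<degree> Ns : A"
  using assms
proof (induction Ns arbitrary: M M')
  case (Cons N Ns)
  have "\<Gamma> \<turnstile>\<^sub>\<omega> M' \<degree> N : B" if "\<Gamma> \<turnstile>\<^sub>\<omega> M \<degree> N : B" for B
    using that Cons.prems(2) by (rule typ_omega_App_mono)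
  then show ?case using Cons.IH[of "M \<degree> N" "M' \<degree> N"] Cons.prems(1) by simp
qed simp

section \<open>The system \<open>\<ell>\<close>\<close>

lemma typ_l_finite: "\<Gamma> \<turnstile>\<^sub>l M : A \<Longrightarrow> finite \<Gamma>"
  by (induction rule: typ_l.induct) auto

lemma typ_l_Var: "\<lbrakk>(x, A) \<in> \<Gamma>; finite \<Gamma>\<rbrakk> \<Longrightarrow> \<Gamma> \<turnstile>\<^sub>l Var x : A"
  using typ_l.Ax[of \<Gamma> x A] by (simp add: insert_absorb)

lemma typ_l_LArr_fresh:
  assumes "(x, B \<^bold>\<rightarrow> C) \<in> \<Gamma>" "\<Gamma> \<turnstile>\<^sub>l N : B"
    and "\<And>y. \<lbrakk>y \<notin> vars \<Gamma>; \<forall>P \<in> set Ns. y \<notin> FV P\<rbrakk> \<Longrightarrow> insert (y, C) \<Gamma> \<turnstile>\<^sub>l Var y \<degree>\<degree> Ns : A"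
  shows "\<Gamma> \<turnstile>\<^sub>l Var x \<degree> N \<degree>\<degree> Ns : A"
proof -
  obtain y where "y \<notin> vars \<Gamma>" "\<forall>P \<in> set Ns. y \<notin> FV P"
    using typ_l_finite[OF assms(2)] by (rule ex_fresh)
  with assms(2,3) have "insert (x, B \<^bold>\<rightarrow> C) \<Gamma> \<turnstile>\<^sub>l Var x \<degree> N \<degree>\<degree> Ns : A"
    by (intro typ_l.LArr)
  with assms(1) show ?thesis by (simp add: insert_absorb)
qed

lemma typ_l_LInt:
  "\<lbrakk>(x, B \<^bold>\<inter> C) \<in> \<Gamma>; insert (x, B) (insert (x, C) \<Gamma>) \<turnstile>\<^sub>l Var x \<degree>\<degree> Ns : A\<rbrakk>
    \<Longrightarrow> \<Gamma> \<turnstile>\<^sub>l Var x \<degree>\<degree> Ns : A"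
  using typ_l.LInt[of x B C \<Gamma> Ns A] by (simp add: insert_absorb)

lemma typ_l_ren:
  assumes "\<Gamma> \<turnstile>\<^sub>l M : A" "finite \<Gamma>'" "renames r \<Gamma> \<Gamma>'"
  shows "\<Gamma>' \<turnstile>\<^sub>l ren r M : A"
  using assms
proof (induction arbitrary: r \<Gamma>' rule: typ_l.induct)
  case (Ax \<Gamma> x A)
  then show ?case by (simp add: typ_l_Var)
next
  case (Beta \<Gamma> M N Ns A)
  then have "\<Gamma>' \<turnstile>\<^sub>l (ren (up_ren r) M)[0 \<^bold>:= ren r N] \<degree>\<degree> map (ren r) Ns : A"
    by (simp flip: ren_subst)
  from typ_l.Beta[OF this] show ?case by simp
next
  case (LArr \<Gamma> N B y C Ns A x)
  have "\<Gamma>' \<turnstile>\<^sub>l Var (r x) \<degree> ren r N \<degree>\<degree> map (ren r) Ns : A"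
  proof (rule typ_l_LArr_fresh)
    show "(r x, B \<^bold>\<rightarrow> C) \<in> \<Gamma>'" using LArr.prems by simp
    show "\<Gamma>' \<turnstile>\<^sub>l ren r N : B" using LArr.prems by (intro LArr.IH(1)) simp_all
  next
    fix z
    have "insert (z, C) \<Gamma>' \<turnstile>\<^sub>l ren (r(y := z)) (Var y \<degree>\<degree> Ns) : A"
      using LArr.prems LArr.hyps by (intro LArr.IH(2) renames_insert_fresh) simp_all
    then show "insert (z, C) \<Gamma>' \<turnstile>\<^sub>l Var z \<degree>\<degree> map (ren r) Ns : A"
      unfolding ren_fun_upd_apps_fresh[OF LArr.hyps(3)] .
  qed
  then show ?case by simp
next
  case (RArr B \<Gamma> M C)
  then show ?case by (simp add: typ_l.RArr renames_bind)
next
  case (LInt x B C \<Gamma> Ns A)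
  let ?\<Gamma>' = "insert (r x, B) (insert (r x, C) \<Gamma>')"
  have "?\<Gamma>' \<turnstile>\<^sub>l ren r (Var x \<degree>\<degree> Ns) : A"
    using LInt.prems by (intro LInt.IH renames_insert) simp_all
  then show ?case using LInt.prems(2) by (auto intro: typ_l_LInt)
qed (simp_all add: typ_l.RInt typ_l.Om)

lemma typ_l_weaken: "\<lbrakk>\<Gamma> \<turnstile>\<^sub>l M : A; \<Gamma> \<subseteq> \<Gamma>'; finite \<Gamma>'\<rbrakk> \<Longrightarrow> \<Gamma>' \<turnstile>\<^sub>l M : A"
  using typ_l_ren[of \<Gamma> M A \<Gamma>' id] by (auto simp: satisfies_def)

lemma typ_l_Inter_iff: "\<Gamma> \<turnstile>\<^sub>l M : A \<^bold>\<inter> B \<longleftrightarrow> \<Gamma> \<turnstile>\<^sub>l M : A \<and> \<Gamma> \<turnstile>\<^sub>l M : B"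
proof
  assume "\<Gamma> \<turnstile>\<^sub>l M : A \<^bold>\<inter> B"
  then show "\<Gamma> \<turnstile>\<^sub>l M : A \<and> \<Gamma> \<turnstile>\<^sub>l M : B"
  proof (induction \<Gamma> M "A \<^bold>\<inter> B" rule: typ_l.induct)
    case (Ax \<Gamma> x)
    have "insert (x, A) (insert (x, B) \<Gamma>) \<turnstile>\<^sub>l Var x \<degree>\<degree> [] : C" if "C \<in> {A, B}" for C
      using that Ax by (auto intro!: typ_l_Var)
    from typ_l.LInt[OF this] show ?case by simp
  qed (blast intro: typ_l.intros)+
qed (simp add: typ_l.RInt)

section \<open>Cut elimination\<close>

primrec neutral :: "tm \<Rightarrow> bool" where
  "neutral (Var i) = True"
| "neutral (M \<degree> N) = neutral M"
| "neutral (Lam M) = False"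

lemma neutral_apps [simp]: "neutral (M \<degree>\<degree> Ns) = neutral M"
  by (induction Ns arbitrary: M) auto

lemma neutral_ren [simp]: "neutral (ren r M) = neutral M"
  by (induction M) auto

text \<open>
  The renaming is part of the statement because the variable \<open>y\<close> of the rule LArr may have to be
  chosen afresh for \<open>N\<close>.
\<close>

lemma typ_l_neutral_ren_App:
  assumes "\<Gamma> \<turnstile>\<^sub>l M : A \<^bold>\<rightarrow> B" "neutral M" "renames r \<Gamma> \<Gamma>'" "\<Gamma>' \<turnstile>\<^sub>l N : A"
  shows "\<Gamma>' \<turnstile>\<^sub>l ren r M \<degree> N : B"
  using assms
proof (induction \<Gamma> M "A \<^bold>\<rightarrow> B" arbitrary: r \<Gamma>' rule: typ_l.induct)
  case (Ax \<Gamma> x)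
  have "finite \<Gamma>'" using Ax.prems(3) by (rule typ_l_finite)
  then have "\<Gamma>' \<turnstile>\<^sub>l Var (r x) \<degree> N \<degree>\<degree> [] : B"
    using Ax.prems by (intro typ_l_LArr_fresh[where B = A and C = B]) (simp_all add: typ_l_Var)
  then show ?case by simp
next
  case (LArr \<Gamma> P C y D Ns x)
  have fin: "finite \<Gamma>'" using LArr.prems(3) by (rule typ_l_finite)
  have "\<Gamma>' \<turnstile>\<^sub>l Var (r x) \<degree> ren r P \<degree>\<degree> (map (ren r) Ns @ [N]) : B"
  proof (rule typ_l_LArr_fresh)
    show "(r x, C \<^bold>\<rightarrow> D) \<in> \<Gamma>'" using LArr.prems by simp
    show "\<Gamma>' \<turnstile>\<^sub>l ren r P : C" using LArr.hyps(1) fin LArr.prems(2) by (simp add: typ_l_ren)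
  next
    fix z
    have "insert (z, D) \<Gamma>' \<turnstile>\<^sub>l N : A"
      using LArr.prems(3) by (rule typ_l_weaken) (auto simp: fin)
    then have "insert (z, D) \<Gamma>' \<turnstile>\<^sub>l ren (r(y := z)) (Var y \<degree>\<degree> Ns) \<degree> N : B"
      using LArr.prems(2) LArr.hyps(6) by (intro LArr.hyps(4) renames_insert_fresh) simp_all
    then show "insert (z, D) \<Gamma>' \<turnstile>\<^sub>l Var z \<degree>\<degree> (map (ren r) Ns @ [N]) : B"
      unfolding ren_fun_upd_apps_fresh[OF LArr.hyps(5)] by simp
  qed
  then show ?case by simp
next
  case (LInt x C D \<Gamma> Ns)
  let ?\<Gamma>' = "insert (r x, C) (insert (r x, D) \<Gamma>')"
  have fin: "finite \<Gamma>'" using LInt.prems(3) by (rule typ_l_finite)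
  have "?\<Gamma>' \<turnstile>\<^sub>l N : A" using LInt.prems(3) by (rule typ_l_weaken) (auto simp: fin)
  then have "?\<Gamma>' \<turnstile>\<^sub>l ren r (Var x \<degree>\<degree> Ns) \<degree> N : B"
    using LInt.prems(1,2) by (intro LInt.hyps(2) renames_insert) simp_all
  then have "?\<Gamma>' \<turnstile>\<^sub>l Var (r x) \<degree>\<degree> (map (ren r) Ns @ [N]) : B" by simp
  from typ_l_LInt[OF _ this] show ?case using LInt.prems(2) by simp
qed simp_all

primrec realizes :: "'a ctx \<Rightarrow> tm \<Rightarrow> 'a ty \<Rightarrow> bool" where
  "realizes \<Gamma> M (Atom a) \<longleftrightarrow> \<Gamma> \<turnstile>\<^sub>l M : Atom a"
| "realizes \<Gamma> M Omega \<longleftrightarrow> finite \<Gamma>"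
| "realizes \<Gamma> M (A \<^bold>\<rightarrow> B) \<longleftrightarrow> \<Gamma> \<turnstile>\<^sub>l M : A \<^bold>\<rightarrow> B \<and>
    (\<forall>r \<Gamma>' N. renames r \<Gamma> \<Gamma>' \<longrightarrow> realizes \<Gamma>' N A \<longrightarrow> realizes \<Gamma>' (ren r M \<degree> N) B)"
| "realizes \<Gamma> M (A \<^bold>\<inter> B) \<longleftrightarrow> realizes \<Gamma> M A \<and> realizes \<Gamma> M B"

lemma realizes_imp_typ_l: "realizes \<Gamma> M A \<Longrightarrow> \<Gamma> \<turnstile>\<^sub>l M : A"
  by (induction A) (simp_all add: typ_l.Om typ_l.RInt)

lemma realizes_App:
  assumes "realizes \<Gamma> M (A \<^bold>\<rightarrow> B)" "realizes \<Gamma> N A"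
  shows "realizes \<Gamma> (M \<degree> N) B"
proof -
  have "renames id \<Gamma> \<Gamma>" by (simp add: satisfies_def)
  with assms have "realizes \<Gamma> (ren id M \<degree> N) B" unfolding realizes.simps by blast
  then show ?thesis by simp
qed

lemma neutral_imp_realizes: "\<lbrakk>\<Gamma> \<turnstile>\<^sub>l M : A; neutral M\<rbrakk> \<Longrightarrow> realizes \<Gamma> M A"
proof (induction A arbitrary: \<Gamma> M)
  case (Arrow A B)
  have "realizes \<Gamma>' (ren r M \<degree> N) B" if "renames r \<Gamma> \<Gamma>'" "realizes \<Gamma>' N A" for r \<Gamma>' N
  proof (rule Arrow.IH(2))
    show "\<Gamma>' \<turnstile>\<^sub>l ren r M \<degree> N : B"
      using Arrow.prems that(1) realizes_imp_typ_l[OF that(2)] by (rule typ_l_neutral_ren_App)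
    show "neutral (ren r M \<degree> N)" using Arrow.prems(2) by simp
  qed
  with Arrow.prems show ?case by simp
qed (auto simp: typ_l_Inter_iff dest: typ_l_finite)

lemma realizes_ren: "\<lbrakk>realizes \<Gamma> M A; finite \<Gamma>'; renames r \<Gamma> \<Gamma>'\<rbrakk> \<Longrightarrow> realizes \<Gamma>' (ren r M) A"
proof (induction A)
  case (Arrow A B)
  have "realizes \<Delta> (ren s (ren r M) \<degree> N) B" if "renames s \<Gamma>' \<Delta>" "realizes \<Delta> N A" for s \<Delta> N
  proof -
    have "renames (s \<circ> r) \<Gamma> \<Delta>"
      using that(1) Arrow.prems(3) by (simp add: satisfies_def)
    then show ?thesis using that(2) Arrow.prems(1) by (simp add: ren_ren)
  qed
  moreover have "\<Gamma>' \<turnstile>\<^sub>l ren r M : A \<^bold>\<rightarrow> B"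
    using realizes_imp_typ_l[OF Arrow.prems(1)] Arrow.prems(2,3) by (rule typ_l_ren)
  ultimately show ?case by simp
qed (auto intro: typ_l_ren)

lemma realizes_beta_expand:
  "realizes \<Gamma> (M[0 \<^bold>:= N] \<degree>\<degree> Ns) A \<Longrightarrow> realizes \<Gamma> (Lam M \<degree> N \<degree>\<degree> Ns) A"
proof (induction A arbitrary: \<Gamma> M N Ns)
  case (Arrow A B)
  have "realizes \<Gamma>' (ren r (Lam M \<degree> N \<degree>\<degree> Ns) \<degree> P) B"
    if "renames r \<Gamma> \<Gamma>'" "realizes \<Gamma>' P A" for r \<Gamma>' P
  proof -
    have "realizes \<Gamma>' (ren r (M[0 \<^bold>:= N] \<degree>\<degree> Ns) \<degree> P) B" using Arrow.prems that by simp
    then have "realizes \<Gamma>' ((ren (up_ren r) M)[0 \<^bold>:= ren r N] \<degree>\<degree> (map (ren r) Ns @ [P])) B"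
      by (simp add: ren_subst)
    from Arrow.IH(2)[OF this] show ?thesis by simp
  qed
  moreover have "\<Gamma> \<turnstile>\<^sub>l Lam M \<degree> N \<degree>\<degree> Ns : A \<^bold>\<rightarrow> B"
    using realizes_imp_typ_l[OF Arrow.prems] by (rule typ_l.Beta)
  ultimately show ?case by simp
qed (auto intro: typ_l.Beta)

lemma realizes_Lam:
  assumes "finite \<Gamma>"
    and body: "\<And>r \<Gamma>' N. \<lbrakk>renames r \<Gamma> \<Gamma>'; realizes \<Gamma>' N A\<rbrakk>
      \<Longrightarrow> realizes \<Gamma>' ((ren (up_ren r) M)[0 \<^bold>:= N]) B"
  shows "realizes \<Gamma> (Lam M) (A \<^bold>\<rightarrow> B)"
proof -
  have "realizes (bind A \<Gamma>) (Var 0) A"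
    using assms(1) by (intro neutral_imp_realizes typ_l_Var) simp_all
  from body[OF renames_Suc_bind this] have "realizes (bind A \<Gamma>) M B"
    by (simp add: ren_up_ren_Suc_subst_Var_0)
  then have "\<Gamma> \<turnstile>\<^sub>l Lam M : A \<^bold>\<rightarrow> B" by (intro typ_l.RArr realizes_imp_typ_l)
  moreover have "realizes \<Gamma>' (ren r (Lam M) \<degree> N) B" if "renames r \<Gamma> \<Gamma>'" "realizes \<Gamma>' N A" for r \<Gamma>' N
    using realizes_beta_expand[of _ _ _ "[]"] body[OF that] by simp
  ultimately show ?thesis by simp
qed

lemma typ_omega_imp_realizes_psub:
  assumes "\<Delta> \<turnstile>\<^sub>\<omega> M : A" "finite \<Gamma>" "satisfies (realizes \<Gamma>) \<sigma> \<Delta>"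
  shows "realizes \<Gamma> (psub \<sigma> M) A"
  using assms
proof (induction arbitrary: \<Gamma> \<sigma> rule: typ_omega.induct)
  case (ArrI A \<Delta> M B)
  have "realizes \<Gamma>' ((ren (up_ren r) (psub (up \<sigma>) M))[0 \<^bold>:= N]) B"
    if ren: "renames r \<Gamma> \<Gamma>'" and arg: "realizes \<Gamma>' N A" for r \<Gamma>' N
  proof -
    have fin: "finite \<Gamma>'" using realizes_imp_typ_l[OF arg] by (rule typ_l_finite)
    have "satisfies (realizes \<Gamma>') (ren r \<circ> \<sigma>) \<Delta>"
      using ArrI.prems(2) by (rule satisfies_mono) (simp add: realizes_ren[OF _ fin ren])
    then have "realizes \<Gamma>' (psub (case_nat N (ren r \<circ> \<sigma>)) M) B"
      using fin arg by (intro ArrI.IH) (simp_all add: satisfies_bind)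
    then show ?thesis by (simp add: ren_psub ren_comp_up psub_up_subst)
  qed
  with ArrI.prems(1) show ?case unfolding psub.simps by (rule realizes_Lam)
next
  case (ArrE \<Delta> M A B N)
  then have "realizes \<Gamma> (psub \<sigma> M) (A \<^bold>\<rightarrow> B)" "realizes \<Gamma> (psub \<sigma> N) A" by blast+
  then show ?case unfolding psub.simps by (rule realizes_App)
qed auto

lemma typ_omega_imp_typ_l:
  assumes "\<Delta> \<turnstile>\<^sub>\<omega> M : A" "finite \<Gamma>" "satisfies (typ_l \<Gamma>) Var \<Delta>"
  shows "\<Gamma> \<turnstile>\<^sub>l M : A"
proof -
  have "satisfies (realizes \<Gamma>) Var \<Delta>"
    using assms(3) by (rule satisfies_mono) (simp add: neutral_imp_realizes)
  from typ_omega_imp_realizes_psub[OF assms(1,2) this] show ?thesis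
    by (simp add: realizes_imp_typ_l)
qed

section \<open>Equivalence of the systems\<close>

lemma typ_l_imp_typ_omega_psub:
  assumes "\<Gamma> \<turnstile>\<^sub>l M : A" "wf_ctx \<Delta>" "satisfies (typ_omega \<Delta>) \<sigma> \<Gamma>"
  shows "\<Delta> \<turnstile>\<^sub>\<omega> psub \<sigma> M : A"
  using assms
proof (induction arbitrary: \<Delta> \<sigma> rule: typ_l.induct)
  case (Beta \<Gamma> M N Ns A)
  then have "\<Delta> \<turnstile>\<^sub>\<omega> (psub (up \<sigma>) M)[0 \<^bold>:= psub \<sigma> N] \<degree>\<degree> map (psub \<sigma>) Ns : A"
    by (simp flip: psub_subst)
  from typ_omega_apps_mono[OF this typ_omega_beta_expand] show ?case by simp
next
  case (LArr \<Gamma> N B y C Ns A x)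
  let ?\<sigma> = "\<sigma>(y := \<sigma> x \<degree> psub \<sigma> N)"
  have "\<Delta> \<turnstile>\<^sub>\<omega> \<sigma> x \<degree> psub \<sigma> N : C"
    using LArr by (auto intro: typ_omega.ArrE)
  then have "satisfies (typ_omega \<Delta>) ?\<sigma> (insert (y, C) \<Gamma>)"
    using LArr.prems(2) LArr.hyps by simp
  then have "\<Delta> \<turnstile>\<^sub>\<omega> psub ?\<sigma> (Var y \<degree>\<degree> Ns) : A" using LArr.prems(1) by (intro LArr.IH(2))
  then show ?case unfolding psub_fun_upd_apps_fresh[OF LArr.hyps(3)] by simp
next
  case (RArr B \<Gamma> M C)
  then have "bind B \<Delta> \<turnstile>\<^sub>\<omega> psub (up \<sigma>) M : C"
    by (intro RArr.IH satisfies_typ_omega_up) simp_all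
  then show ?case by (simp add: typ_omega.ArrI)
next
  case (LInt x B C \<Gamma> Ns A)
  then show ?case by (simp add: typ_omega_Inter_iff)
qed (simp_all add: typ_omega_Inter_iff typ_omega_Omega)

lemma typ_s_iff_typ_l: "\<Gamma> \<turnstile>\<^sub>s M : A \<longleftrightarrow> \<Gamma> \<turnstile>\<^sub>l M : A"
proof
  show "\<Gamma> \<turnstile>\<^sub>l M : A" if "\<Gamma> \<turnstile>\<^sub>s M : A"
    using that by (induction rule: typ_s.induct) (auto intro: typ_l.intros)
  show "\<Gamma> \<turnstile>\<^sub>s M : A" if "\<Gamma> \<turnstile>\<^sub>l M : A"
    using that
  proof (induction rule: typ_l.induct)
    case (Beta \<Gamma> M N Ns A)
    then have "\<Gamma> \<turnstile>\<^sub>s N : Omega" by (blast intro: typ_s.Om dest: typ_l_finite)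
    with Beta.IH show ?case by (rule typ_s.Beta)
  qed (auto intro: typ_s.intros)
qed

theorem theorem8:
  fixes \<Gamma> \<Delta> :: "'a ctx" and M :: tm and A :: "'a ty"
  assumes "finite \<Gamma>" and "inter_ctx \<Gamma> \<Delta>"
  shows "(\<Delta> \<turnstile>\<^sub>\<omega> M : A \<longleftrightarrow> \<Gamma> \<turnstile>\<^sub>s M : A) \<and> (\<Gamma> \<turnstile>\<^sub>s M : A \<longleftrightarrow> \<Gamma> \<turnstile>\<^sub>l M : A)"
proof -
  have "\<Gamma> \<turnstile>\<^sub>l M : A" if "\<Delta> \<turnstile>\<^sub>\<omega> M : A"
  proof (rule typ_omega_imp_typ_l[OF that assms(1)])
    have "satisfies (typ_l \<Gamma>) Var \<Gamma>" using assms(1) by (simp add: satisfies_def typ_l_Var)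
    then show "satisfies (typ_l \<Gamma>) Var \<Delta>"
      by (simp add: satisfies_inter_ctx_iff[OF assms(2)] typ_l_Inter_iff)
  qed
  moreover have "\<Delta> \<turnstile>\<^sub>\<omega> M : A" if "\<Gamma> \<turnstile>\<^sub>l M : A"
  proof -
    have wf: "wf_ctx \<Delta>" using assms by (rule wf_ctx_inter_ctx)
    then have "satisfies (typ_omega \<Delta>) Var \<Gamma>"
      by (simp add: satisfies_typ_omega_Var flip: satisfies_typ_omega_inter_ctx_iff[OF assms(2)])
    from typ_l_imp_typ_omega_psub[OF that wf this] show ?thesis by simp
  qed
  ultimately show ?thesis by (auto simp: typ_s_iff_typ_l)
qed

end
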